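(* Let $C$ be a normal closed cone with nonempty interior $C^\circ$ in a real Banach space $X$ and let $f\colon C^\circ\to C^\circ$ be a fixed point free order-preserving homogeneous mapping, with $r_{C^\circ}(f)=1$, satisfying the fixed point property on $C^\circ$ with respect to $d_C$. Let $q\colon C^\circ\to(0,\infty)$ be a continuous homogeneous function, let $\Sigma^\circ=\{x\in C^\circ\colon q(x)=1\}$, and let $g\colon\Sigma^\circ\to\Sigma^\circ$ be given by $g(x)=\frac{f(x)}{q(f(x))}$. If there exists $x_0\in C^\circ$ such that $\mathcal{O}(x_0;f)$ and $\mathcal{O}(x_0/q(x_0);g)$ have compact closures in the norm topology, then there exists a convex set $\Omega\subseteq\partial C$ such that $\omega(z;g)\subseteq\Omega$ for all $z\in\Sigma^\circ$.
   Context: A cone $C\subseteq X$ is a convex set with $C\cap(-C)=\{0\}$ and $\lambda C\subseteq C$ for all $\lambda\ge0$; $x\le_C y$ means $y-x\in C$. $C$ is normal if there is $\kappa\ge0$ with $\|x\|\le\kappa\|y\|$ whenever $0\le_C x\le_C y$. $f$ is order-preserving if $x\le_C y$ implies $f(x)\le_C f(y)$; homogeneous means $f(\lambda x)=\lambda f(x)$ (resp. $q(\lambda x)=\lambda q(x)$) for all $\lambda>0$; $q$ is continuous for the norm topology. The partial spectral radius is $r_{C^\circ}(f)=\lim_{k\to\infty}\|f^k\|_{C^\circ}^{1/k}$ with $\|f^k\|_{C^\circ}=\sup\{\|f^k(x)\|\colon x\in C^\circ,\|x\|\le1\}$. Thompson's metric on $C^\circ$ is $d_C(x,y)=\log\max\{M(x/y),M(y/x)\}$,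 where $M(x/y)=\inf\{\beta\in\mathbb{R}\colon x\le_C\beta y\}$. A continuous map $f\colon C^\circ\to C^\circ$ has the fixed point property on $C^\circ$ with respect to $d_C$ if for each nonempty, bounded, convex, closed subset $D$ of $(C^\circ,d_C)$ with $f(D)\subseteq D$, $f$ has a fixed point in $D$. For a self-map $h$, $\mathcal{O}(x;h)=\{h^k(x)\colon k\ge0\}$ and $\omega(x;h)$ is the set of limits in the norm topology of subsequences $(h^{k_i}(x))_i$ with $k_i\to\infty$. *)

theory Defs
  imports "HOL-Analysis.Analysis"
begin

definition pointed_cone :: "'a::real_vector set \<Rightarrow> bool" where
  "pointed_cone C \<longleftrightarrow> convex C \<and> cone C \<and> C \<inter> uminus ` C = {0}"

definition cone_le :: "'a::real_vector set \<Rightarrow> 'a \<Rightarrow> 'a \<Rightarrow> bool" where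
  "cone_le C x y \<longleftrightarrow> y - x \<in> C"

definition normal_cone :: "'a::real_normed_vector set \<Rightarrow> bool" where
  "normal_cone C \<longleftrightarrow>
     (\<exists>\<kappa>\<ge>0. \<forall>x y. cone_le C 0 x \<and> cone_le C x y \<longrightarrow> norm x \<le> \<kappa> * norm y)"

definition order_preserving_on ::
    "'a::real_vector set \<Rightarrow> 'a set \<Rightarrow> ('a \<Rightarrow> 'a) \<Rightarrow> bool" where
  "order_preserving_on C K f \<longleftrightarrow> (\<forall>x\<in>K. \<forall>y\<in>K. cone_le C x y \<longrightarrow> cone_le C (f x) (f y))"

definition homogeneous_on ::
    "'a::real_vector set \<Rightarrow> ('a \<Rightarrow> 'b::real_vector) \<Rightarrow> bool" where
  "homogeneous_on K h \<longleftrightarrow> (\<forall>x\<in>K. \<forall>t>0. h (t *\<^sub>R x) = t *\<^sub>R h x)"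

text \<open>
  The supremum is taken in \<^typ>\<open>real\<close>. If \<open>C\<close> is a normal cone and \<open>h\<close> is an order-preserving
  homogeneous self-map of its interior, then it is finite: for \<open>u\<close> in the interior there is
  \<open>r > 0\<close> such that \<open>x \<le> r u\<close>, hence \<open>h x \<le> r (h u)\<close>, for all \<open>x\<close> of norm at most 1.
  By submultiplicativity the limit defining the partial spectral radius then exists.
\<close>

definition partial_norm :: "'a::real_normed_vector set \<Rightarrow> ('a \<Rightarrow> 'a) \<Rightarrow> real" where
  "partial_norm K h = (SUP x\<in>{x \<in> K. norm x \<le> 1}. norm (h x))"

definition partial_spectral_radius :: "'a::real_normed_vector set \<Rightarrow> ('a \<Rightarrow> 'a) \<Rightarrow> real" where
  "partial_spectral_radius K f = lim (\<lambda>k. root k (partial_norm K (f ^^ k)))"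

definition gauge_M :: "'a::real_vector set \<Rightarrow> 'a \<Rightarrow> 'a \<Rightarrow> real" where
  "gauge_M C x y = Inf {\<beta>. cone_le C x (\<beta> *\<^sub>R y)}"

text \<open>
  The value 0 outside the interior is a dummy: the locale \<^locale>\<open>Metric_space\<close> requires the
  distance function to be nonnegative and symmetric on the whole type.
\<close>

definition thompson_dist :: "'a::real_normed_vector set \<Rightarrow> 'a \<Rightarrow> 'a \<Rightarrow> real" where
  "thompson_dist C x y =
     (if x \<in> interior C \<and> y \<in> interior C then ln (max (gauge_M C x y) (gauge_M C y x)) else 0)"

definition fixed_point_property ::
    "'a::real_vector set \<Rightarrow> ('a \<Rightarrow> 'a \<Rightarrow> real) \<Rightarrow> ('a \<Rightarrow> 'a) \<Rightarrow> bool" where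
  "fixed_point_property M d f \<longleftrightarrow>
     continuous_map (Metric_space.mtopology M d) (Metric_space.mtopology M d) f \<and>
     (\<forall>D. D \<noteq> {} \<and> Metric_space.mbounded M d D \<and> convex D \<and>
          closedin (Metric_space.mtopology M d) D \<and> f ` D \<subseteq> D \<longrightarrow>
          (\<exists>x\<in>D. f x = x))"

definition orbit_of :: "'a \<Rightarrow> ('a \<Rightarrow> 'a) \<Rightarrow> 'a set" where
  "orbit_of x h = {(h ^^ k) x | k. True}"

definition omega_limit :: "'a::topological_space \<Rightarrow> ('a \<Rightarrow> 'a) \<Rightarrow> 'a set" where
  "omega_limit x h =
     {y. \<exists>k::nat \<Rightarrow> nat. filterlim k at_top sequentially \<and> (\<lambda>i. (h ^^ k i) x) \<longlonglongrightarrow> y}"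

text \<open>
  The metric space notions used in the fixed point property are meaningful for Thompson's metric.
  The assumption on 0 excludes only the zero space.
\<close>

lemma Metric_space_thompson_dist:
  fixes C :: "'a::real_normed_vector set"
  assumes C: "pointed_cone C" "closed C" and z: "0 \<notin> interior C"
  shows "Metric_space (interior C) (thompson_dist C)"
proof -
  have add: "x + y \<in> C" if "x \<in> C" "y \<in> C" for x y
    using C that by (metis convex_cone pointed_cone_def)
  have scale: "t *\<^sub>R x \<in> C" if "x \<in> C" "t \<ge> 0" for t x
    using C that by (auto simp: pointed_cone_def cone_def)
  have pt: "x = 0" if "x \<in> C" "- x \<in> C" for x
  proof -
    have "x \<in> C \<inter> uminus ` C" using that by (metis IntI image_eqI minus_minus)
    then show ?thesis using C by (auto simp: pointed_cone_def)
  qed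
  have int: "x \<in> C" "x \<noteq> 0" if "x \<in> interior C" for x
    using that z interior_subset by blast+
  have trans: "cone_le C x w" if "cone_le C x y" "cone_le C y w" for x y w
    using add[of "y - x" "w - y"] that by (simp add: cone_le_def algebra_simps)
  have sc: "cone_le C (t *\<^sub>R x) (t *\<^sub>R y)" if "cone_le C x y" "t \<ge> 0" for t x y
    using scale[of "y - x" t] that by (simp add: cone_le_def scaleR_diff_right)
  have ex: "\<exists>\<beta>. cone_le C x (\<beta> *\<^sub>R y)" if y: "y \<in> interior C" for x y
  proof -
    obtain e where e: "e > 0" "ball y e \<subseteq> C" using y by (auto simp: mem_interior)
    define t where "t = e / 2 / (norm x + 1)"
    have t: "t > 0" using e by (simp add: t_def add_nonneg_pos)
    have "t * norm x < e"
    proof -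
      have "t * norm x \<le> t * (norm x + 1)" using t by simp
      also have "\<dots> = e / 2"
      proof -
        have "norm x + 1 \<noteq> 0" using norm_ge_zero[of x] by linarith
        then show ?thesis unfolding t_def by (metis nonzero_eq_divide_eq)
      qed
      finally show ?thesis using e by simp
    qed
    then have "y - t *\<^sub>R x \<in> C"
      using e t by (intro subsetD[OF e(2)]) (simp add: dist_norm)
    from scale[OF this, of "1 / t"] t have "(1 / t) *\<^sub>R y - x \<in> C"
      by (simp add: scaleR_diff_right)
    then show ?thesis by (auto simp: cone_le_def)
  qed
  have pos: "\<beta> > 0" if "x \<in> interior C" "y \<in> interior C" "cone_le C x (\<beta> *\<^sub>R y)" for x y \<beta>
  proof (rule ccontr)
    assume "\<not> \<beta> > 0"
    then have "(- \<beta>) *\<^sub>R y \<in> C" using int that by (intro scale) auto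
    with add[of "\<beta> *\<^sub>R y - x" "(- \<beta>) *\<^sub>R y"] that have "- x \<in> C" by (simp add: cone_le_def)
    then show False using pt int that by blast
  qed
  have att: "cone_le C x (gauge_M C x y *\<^sub>R y)"
    and low: "\<And>\<beta>. cone_le C x (\<beta> *\<^sub>R y) \<Longrightarrow> gauge_M C x y \<le> \<beta>"
    if xy: "x \<in> interior C" "y \<in> interior C" for x y
  proof -
    let ?S = "{\<beta>. cone_le C x (\<beta> *\<^sub>R y)}"
    have bdd: "bdd_below ?S" using pos[OF xy] by (intro bdd_belowI[of _ 0]) (auto intro: less_imp_le)
    have "closed ((\<lambda>\<beta>. \<beta> *\<^sub>R y - x) -` C)"
      using C by (intro closed_vimage continuous_intros)
    then have "closed ?S" by (simp add: cone_le_def vimage_def)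
    then have "Inf ?S \<in> ?S" using ex[OF xy(2)] bdd by (intro closed_contains_Inf) auto
    then show "cone_le C x (gauge_M C x y *\<^sub>R y)" by (simp add: gauge_M_def)
    show "gauge_M C x y \<le> \<beta>" if "cone_le C x (\<beta> *\<^sub>R y)" for \<beta>
      using that bdd unfolding gauge_M_def by (intro cInf_lower) auto
  qed
  have Mpos: "gauge_M C x y > 0" if "x \<in> interior C" "y \<in> interior C" for x y
    using att pos that by blast
  have mult: "gauge_M C x w \<le> gauge_M C x y * gauge_M C y w"
    if "x \<in> interior C" "y \<in> interior C" "w \<in> interior C" for x y w
  proof (rule low)
    have "cone_le C (gauge_M C x y *\<^sub>R y) (gauge_M C x y *\<^sub>R gauge_M C y w *\<^sub>R w)"
      by (rule sc[OF att[OF that(2,3)] less_imp_le[OF Mpos[OF that(1,2)]]])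
    then show "cone_le C x ((gauge_M C x y * gauge_M C y w) *\<^sub>R w)"
      using trans[OF att[OF that(1,2)]] by simp
  qed (use that in auto)
  have M1: "gauge_M C x x = 1" if x: "x \<in> interior C" for x
  proof (rule antisym)
    have "0 \<in> C" using C by (auto simp: pointed_cone_def)
    then show "gauge_M C x x \<le> 1" by (intro low x) (simp add: cone_le_def)
    show "1 \<le> gauge_M C x x"
    proof (rule ccontr)
      assume a: "\<not> 1 \<le> gauge_M C x x"
      have "(gauge_M C x x - 1) *\<^sub>R x \<in> C"
        using att[OF x x] by (simp add: cone_le_def scaleR_diff_left)
      from scale[OF this, of "1 / (1 - gauge_M C x x)"] a
      have "((gauge_M C x x - 1) / (1 - gauge_M C x x)) *\<^sub>R x \<in> C" by simp
      moreover have "(gauge_M C x x - 1) / (1 - gauge_M C x x) = - 1"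
        using a by (simp add: field_simps)
      ultimately have "- x \<in> C" by simp
      then show False using pt int x by blast
    qed
  qed
  define m where "m = (\<lambda>x y. max (gauge_M C x y) (gauge_M C y x))"
  have m1: "m x y \<ge> 1" if "x \<in> interior C" "y \<in> interior C" for x y
  proof (rule ccontr)
    assume "\<not> m x y \<ge> 1"
    then have "gauge_M C x y < 1" "gauge_M C y x < 1" by (auto simp: m_def)
    then have "gauge_M C x y * gauge_M C y x < 1 * 1"
      using Mpos that by (intro mult_strict_mono) (auto intro: less_imp_le)
    with mult[of x y x] M1[of x] that show False by simp
  qed
  show ?thesis
  proof
    show "0 \<le> thompson_dist C x y" for x y
      using m1[of x y] by (auto simp: thompson_dist_def m_def)
    show "thompson_dist C x y = thompson_dist C y x" for x y
      by (auto simp: thompson_dist_def max.commute)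
    show "thompson_dist C x y = 0 \<longleftrightarrow> x = y" if xy: "x \<in> interior C" "y \<in> interior C" for x y
    proof
      assume "thompson_dist C x y = 0"
      then have "m x y = 1" using xy m1[of x y] by (simp add: thompson_dist_def m_def)
      then have "gauge_M C x y \<le> 1" "gauge_M C y x \<le> 1" unfolding m_def by linarith+
      moreover have "cone_le C u v" if "gauge_M C u v \<le> 1" "u \<in> interior C" "v \<in> interior C" for u v
      proof -
        have "(1 - gauge_M C u v) *\<^sub>R v \<in> C" using int that by (intro scale) auto
        then have "cone_le C (gauge_M C u v *\<^sub>R v) v" by (simp add: cone_le_def algebra_simps)
        then show ?thesis using trans att that by blast
      qed
      ultimately have "cone_le C x y" "cone_le C y x" using xy by blast+
      then have "y - x = 0" using pt[of "y - x"] by (simp add: cone_le_def)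
      then show "x = y" by simp
    next
      assume "x = y"
      then show "thompson_dist C x y = 0" using xy M1 by (simp add: thompson_dist_def)
    qed
    show "thompson_dist C x w \<le> thompson_dist C x y + thompson_dist C y w"
      if "x \<in> interior C" "y \<in> interior C" "w \<in> interior C" for x y w
    proof -
      have a: "gauge_M C u v * gauge_M C v t \<le> m u v * m v t"
        if "u \<in> interior C" "v \<in> interior C" "t \<in> interior C" for u v t
        using Mpos m1 that
        by (intro mult_mono) (auto simp: m_def less_imp_le intro: order_trans[of 0 1] max.coboundedI1)
      have comm: "m u v = m v u" for u v by (simp add: m_def max.commute)
      have "gauge_M C x w \<le> m x y * m y w" using mult a that by (meson order_trans)
      moreover have "gauge_M C w x \<le> m x y * m y w"
        using mult[of w y x] a[of w y x] comm that by (simp add: mult.commute)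
      ultimately have "m x w \<le> m x y * m y w" by (simp add: m_def)
      moreover have "0 < m x y" "0 < m y w" "0 < m x w"
        using m1 that by (meson less_le_trans zero_less_one)+
      ultimately have "ln (m x w) \<le> ln (m x y) + ln (m y w)"
        by (simp flip: ln_mult_pos)
      then show ?thesis using that by (simp add: thompson_dist_def m_def)
    qed
  qed
qed

end

theory Submission
  imports Defs
begin

text \<open>
  Write \<open>\<le>\<close> for the order of \<open>C\<close> and let the orbit of \<open>x\<close> under \<open>f\<close> be norm bounded. Then
  \<open>f\<^sup>m x \<le> R x\<close> for some \<open>R\<close> and all \<open>m\<close>, because \<open>x\<close> is an order unit, and applying \<open>f\<^sup>p\<close> gives
  \<open>f\<^sup>N x \<le> R (f\<^sup>p x)\<close> whenever \<open>N \<ge> p\<close>: each iterate dominates all later ones with the same constant.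
  The set \<open>\<Omega>\<close> of all \<open>v \<in> C\<close> for which some \<open>t \<ge> 0\<close> satisfies \<open>v \<le> t (f\<^sup>p x)\<close> for all \<open>p\<close> is a
  convex cone, and it has the two required properties.

  \<^item> It misses the interior of \<open>C\<close>. An interior point of \<open>C\<close> in \<open>\<Omega>\<close> would give \<open>x \<le> S (f\<^sup>p x)\<close> for
    all \<open>p\<close>, so the orbit of \<open>x\<close> would be bounded in Thompson's metric. A bounded orbit yields a
    nonempty bounded closed convex invariant set, hence a fixed point
    (\<open>bounded_orbit_fixed_point\<close>).

  \<^item> It contains every limit \<open>w\<close> of a subsequence of \<open>g\<^sup>N z = f\<^sup>N z / q (f\<^sup>N z)\<close>. From \<open>z \<le> s x\<close> one has
    \<open>f\<^sup>N z \<le> s (f\<^sup>N x) \<le> s R (f\<^sup>p x)\<close> for \<open>N \<ge> p\<close>, so it is enough to bound \<open>1 / q (f\<^sup>N z)\<close> along the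
    subsequence. Since \<open>g\<^sup>N z\<close> is bounded there, this could fail only if \<open>f\<^sup>N z\<close> came arbitrarily close
    to 0. Then \<open>f\<^sup>k z \<le> z / 2\<close> for some \<open>k \<ge> 1\<close>, which by normality of \<open>C\<close> makes the partial
    spectral radius smaller than 1 (\<open>no_contraction\<close>).
\<close>

section \<open>Submultiplicative sequences\<close>

text \<open>
  Fekete's lemma in multiplicative form. Convergence is part of the conclusion because \<^const>\<open>lim\<close>
  carries no information about a divergent sequence.
\<close>

lemma submultiplicative_root_limit:
  fixes p :: "nat \<Rightarrow> real"
  assumes pos: "\<And>n. 0 < p n" and sub: "\<And>m n. p (m + n) \<le> p m * p n"
  obtains L where "(\<lambda>n. root n (p n)) \<longlonglongrightarrow> L" and "\<And>m. 1 \<le> m \<Longrightarrow> L ^ m \<le> p m"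
proof
  define L where "L = (INF n\<in>{1..}. root n (p n))"
  have nonneg: "0 \<le> root n (p n)" for n
    using pos[of n] by (simp add: real_root_ge_zero)
  have bdd: "bdd_below ((\<lambda>n. root n (p n)) ` {1..})"
    using nonneg by (intro bdd_belowI[of _ 0]) auto
  have lower: "L \<le> root n (p n)" if "1 \<le> n" for n
    unfolding L_def using that by (intro cINF_lower[OF bdd]) auto
  have L0: "0 \<le> L"
    unfolding L_def using nonneg by (intro cINF_greatest) auto
  show "L ^ m \<le> p m" if m: "1 \<le> m" for m
  proof -
    have "L ^ m \<le> root m (p m) ^ m" by (rule power_mono[OF lower[OF m] L0])
    also have "\<dots> = p m" using m pos[of m] by (intro real_root_pow_pos2) auto
    finally show ?thesis .
  qed
  have upper: "\<forall>\<^sub>F n in sequentially. root n (p n) < a" if a: "L < a" for a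
  proof -
    have "\<exists>m\<in>{1..}. root m (p m) < (L + a) / 2"
    proof (rule ccontr)
      assume "\<not> ?thesis"
      then have "(L + a) / 2 \<le> L" unfolding L_def by (intro cINF_greatest) (auto simp: not_less)
      with a show False by simp
    qed
    then obtain m where m: "1 \<le> m" "root m (p m) < (L + a) / 2" by auto
    define c where "c = (L + a) / 2"
    have c: "0 < c" "c < a" using a L0 by (auto simp: c_def)
    have "p m = root m (p m) ^ m" using m pos[of m] by simp
    also have "\<dots> \<le> c ^ m" using m(2) nonneg by (intro power_mono) (auto simp: c_def)
    finally have pm: "p m \<le> c ^ m" .
    define B where "B = (\<Sum>r<m. p r / c ^ r)"
    have B: "p r \<le> B * c ^ r" if "r < m" for r
    proof -
      have "p r / c ^ r \<le> B" unfolding B_def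
        using that c pos by (intro member_le_sum) (auto simp: less_imp_le)
      then show ?thesis using c by (simp add: field_simps)
    qed
    have "0 < p 0 / c ^ 0" using pos by simp
    also have "\<dots> \<le> B" unfolding B_def using m c pos by (intro member_le_sum) (auto simp: less_imp_le)
    finally have B0: "0 < B" .
    have step: "p (d * m + r) \<le> B * c ^ (d * m + r)" if "r < m" for d r
    proof (induction d)
      case 0 then show ?case using B[OF that] by simp
    next
      case (Suc d)
      have "p (Suc d * m + r) \<le> p m * p (d * m + r)" using sub[of m "d * m + r"] by (simp add: algebra_simps)
      also have "\<dots> \<le> c ^ m * (B * c ^ (d * m + r))"
        using Suc pm pos c by (intro mult_mono) (auto simp: less_imp_le)
      also have "\<dots> = B * c ^ (Suc d * m + r)" by (simp add: power_add algebra_simps)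
      finally show ?case .
    qed
    have bound: "root n (p n) \<le> root n B * c" if n: "0 < n" for n
    proof -
      have "p n \<le> B * c ^ n" using step[of "n mod m" "n div m"] m by simp
      then have "root n (p n) \<le> root n (B * c ^ n)" using n by simp
      also have "\<dots> = root n B * c" using n c by (simp add: real_root_mult real_root_power_cancel)
      finally show ?thesis .
    qed
    have "(\<lambda>n. root n B * c) \<longlonglongrightarrow> 1 * c" by (intro tendsto_intros LIMSEQ_root_const B0)
    then have "\<forall>\<^sub>F n in sequentially. root n B * c < a" using c by (intro order_tendstoD) auto
    then show ?thesis using eventually_gt_at_top[of 0]
      by eventually_elim (rule le_less_trans[OF bound])
  qed
  show "(\<lambda>n. root n (p n)) \<longlonglongrightarrow> L"
  proof (rule order_tendstoI)
    show "\<forall>\<^sub>F n in sequentially. a < root n (p n)" if "a < L" for a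
      using eventually_ge_at_top[of 1] by eventually_elim (rule less_le_trans[OF that lower])
  qed (rule upper)
qed

section \<open>The order of a closed cone and its gauge\<close>

locale closed_cone =
  fixes C :: "'a::real_normed_vector set"
  assumes pointed: "pointed_cone C" and closed: "closed C"
begin

abbreviation le (infix "\<preceq>" 50) where "x \<preceq> y \<equiv> cone_le C x y"

lemma add_mem: "x \<in> C \<Longrightarrow> y \<in> C \<Longrightarrow> x + y \<in> C"
  using pointed by (metis convex_cone pointed_cone_def)

lemma scale_mem: "x \<in> C \<Longrightarrow> 0 \<le> t \<Longrightarrow> t *\<^sub>R x \<in> C"
  using pointed by (auto simp: pointed_cone_def cone_def)

lemma zero_mem: "0 \<in> C"
  using pointed by (auto simp: pointed_cone_def)

lemma opposite_mem_zero:
  assumes "x \<in> C" "- x \<in> C" shows "x = 0"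
proof -
  have "x \<in> C \<inter> uminus ` C" using assms by (metis IntI image_eqI minus_minus)
  then show ?thesis using pointed by (auto simp: pointed_cone_def)
qed

lemma le_refl: "x \<preceq> x"
  by (simp add: cone_le_def zero_mem)

lemma le_trans [trans]: "x \<preceq> y \<Longrightarrow> y \<preceq> z \<Longrightarrow> x \<preceq> z"
  using add_mem[of "y - x" "z - y"] by (simp add: cone_le_def algebra_simps)

lemma le_add: "x \<preceq> y \<Longrightarrow> u \<preceq> v \<Longrightarrow> x + u \<preceq> y + v"
  using add_mem[of "y - x" "v - u"] by (simp add: cone_le_def algebra_simps)

lemma le_scale: "x \<preceq> y \<Longrightarrow> 0 \<le> t \<Longrightarrow> t *\<^sub>R x \<preceq> t *\<^sub>R y"
  using scale_mem[of "y - x" t] by (simp add: cone_le_def scaleR_diff_right)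

lemma le_scale_left: "x \<in> C \<Longrightarrow> s \<le> t \<Longrightarrow> s *\<^sub>R x \<preceq> t *\<^sub>R x"
  using scale_mem[of x "t - s"] by (simp add: cone_le_def scaleR_diff_left)

lemma le_limit:
  assumes "X \<longlonglongrightarrow> x" and "\<forall>\<^sub>F n in sequentially. X n \<preceq> y"
  shows "x \<preceq> y"
proof -
  have "(\<lambda>n. y - X n) \<longlonglongrightarrow> y - x" using assms by (intro tendsto_intros)
  then show ?thesis
    using Lim_in_closed_set[OF closed, of "\<lambda>n. y - X n" sequentially "y - x"] assms(2)
    by (simp add: cone_le_def)
qed

lemma interior_scale:
  assumes "x \<in> interior C" "0 < t" shows "t *\<^sub>R x \<in> interior C"
proof -
  have "(*\<^sub>R) t ` interior C \<subseteq> C" using assms scale_mem interior_subset by force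
  moreover have "open ((*\<^sub>R) t ` interior C)" using assms by (intro open_scaling) auto
  ultimately show ?thesis using assms by (auto intro!: interiorI)
qed

text \<open>Every interior point is an order unit, uniformly on bounded sets.\<close>

lemma interior_order_unit:
  assumes u: "u \<in> interior C"
  obtains R where "0 < R" and "\<And>x. x \<preceq> (R * norm x) *\<^sub>R u"
proof -
  obtain e where e: "0 < e" "ball u e \<subseteq> C" using u by (auto simp: mem_interior)
  have "x \<preceq> (2 / e * norm x) *\<^sub>R u" for x
  proof (cases "x = 0")
    case True then show ?thesis by (simp add: le_refl)
  next
    case False
    define t where "t = e / 2 / norm x"
    have t: "0 < t" using e False by (simp add: t_def)
    have "u - t *\<^sub>R x \<in> ball u e" using e t False by (simp add: dist_norm t_def)
    then have "t *\<^sub>R x \<preceq> u" using e by (auto simp: cone_le_def)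
    from le_scale[OF this, of "1 / t"] t have "x \<preceq> (1 / t) *\<^sub>R u" by simp
    also have "1 / t = 2 / e * norm x" using e False by (simp add: t_def)
    finally show ?thesis .
  qed
  with e show ?thesis by (intro that[of "2 / e"]) auto
qed

end

text \<open>
  The condition on 0 excludes only the zero space; it makes Thompson's distance a metric on the
  interior of the cone.
\<close>

locale solid_cone = closed_cone +
  assumes zero_not_interior: "0 \<notin> interior C"
begin

sublocale T: Metric_space "interior C" "thompson_dist C"
  by (intro Metric_space_thompson_dist pointed closed zero_not_interior)

lemma interior_le_scale_pos:
  assumes "x \<in> interior C" "y \<in> interior C" "x \<preceq> b *\<^sub>R y" shows "0 < b"
proof (rule ccontr)
  assume "\<not> 0 < b"
  then have "b *\<^sub>R y \<preceq> 0 *\<^sub>R y" using assms interior_subset by (intro le_scale_left) auto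
  from le_trans[OF assms(3) this] have "x \<preceq> 0" by simp
  then show False
    using opposite_mem_zero[of x] assms zero_not_interior interior_subset
    by (auto simp: cone_le_def)
qed

lemma gauge_M_interior:
  assumes x: "x \<in> interior C" and y: "y \<in> interior C"
  shows gauge_M_attained: "x \<preceq> gauge_M C x y *\<^sub>R y"
    and gauge_M_pos: "0 < gauge_M C x y"
    and gauge_M_lower: "\<And>b. x \<preceq> b *\<^sub>R y \<Longrightarrow> gauge_M C x y \<le> b"
proof -
  let ?S = "{b. x \<preceq> b *\<^sub>R y}"
  have bdd: "bdd_below ?S"
    using interior_le_scale_pos[OF x y] by (intro bdd_belowI[of _ 0]) (auto intro: less_imp_le)
  obtain R where "x \<preceq> (R * norm x) *\<^sub>R y" using interior_order_unit[OF y] by metis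
  then have ne: "?S \<noteq> {}" by auto
  have "closed ((\<lambda>b. b *\<^sub>R y - x) -` C)"
    using closed by (intro closed_vimage continuous_intros)
  then have "closed ?S" by (simp add: cone_le_def vimage_def)
  then have "Inf ?S \<in> ?S" using ne bdd by (intro closed_contains_Inf) auto
  then show *: "x \<preceq> gauge_M C x y *\<^sub>R y" by (simp add: gauge_M_def)
  show "0 < gauge_M C x y" by (rule interior_le_scale_pos[OF x y *])
  show "gauge_M C x y \<le> b" if "x \<preceq> b *\<^sub>R y" for b
    using that bdd unfolding gauge_M_def by (intro cInf_lower) auto
qed

lemma thompson_dist_le:
  assumes "x \<in> interior C" "y \<in> interior C" "x \<preceq> b *\<^sub>R y" "y \<preceq> b *\<^sub>R x"
  shows "thompson_dist C x y \<le> ln b"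
proof -
  have "max (gauge_M C x y) (gauge_M C y x) \<le> b" "0 < max (gauge_M C x y) (gauge_M C y x)"
    using assms gauge_M_lower gauge_M_pos by (auto simp: less_max_iff_disj)
  then show ?thesis using assms by (simp add: thompson_dist_def ln_mono)
qed

lemma le_of_thompson_dist_less:
  assumes "x \<in> interior C" "y \<in> interior C" "thompson_dist C x y < ln b" "0 < b"
  shows "x \<preceq> b *\<^sub>R y" "y \<preceq> b *\<^sub>R x"
proof -
  have pos: "0 < max (gauge_M C x y) (gauge_M C y x)"
    using assms gauge_M_pos by (auto simp: less_max_iff_disj)
  then have "max (gauge_M C x y) (gauge_M C y x) < b"
    using assms by (simp add: thompson_dist_def)
  then have le: "gauge_M C x y \<le> b" "gauge_M C y x \<le> b" by auto
  have C: "x \<in> C" "y \<in> C" using assms interior_subset by auto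
  show "x \<preceq> b *\<^sub>R y"
    using le_trans[OF gauge_M_attained[OF assms(1,2)] le_scale_left[OF C(2) le(1)]] .
  show "y \<preceq> b *\<^sub>R x"
    using le_trans[OF gauge_M_attained[OF assms(2,1)] le_scale_left[OF C(1) le(2)]] .
qed

end

section \<open>Order-preserving homogeneous maps\<close>

locale cone_map = solid_cone +
  fixes f :: "'a \<Rightarrow> 'a"
  assumes self_map: "f ` interior C \<subseteq> interior C"
    and order_preserving: "order_preserving_on C (interior C) f"
    and homogeneous: "homogeneous_on (interior C) f"
begin

lemma iter_interior: "x \<in> interior C \<Longrightarrow> (f ^^ k) x \<in> interior C"
  using self_map by (induction k) auto

lemma iter_scale:
  assumes "x \<in> interior C" "0 < t"
  shows "(f ^^ k) (t *\<^sub>R x) = t *\<^sub>R (f ^^ k) x"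
  using assms homogeneous iter_interior by (induction k) (auto simp: homogeneous_on_def)

lemma iter_mono:
  assumes "x \<in> interior C" "y \<in> interior C" "x \<preceq> y"
  shows "(f ^^ k) x \<preceq> (f ^^ k) y"
  using assms order_preserving iter_interior by (induction k) (auto simp: order_preserving_on_def)

lemma iter_le_scale:
  assumes "x \<in> interior C" "y \<in> interior C" "0 < t" "x \<preceq> t *\<^sub>R y"
  shows "(f ^^ k) x \<preceq> t *\<^sub>R (f ^^ k) y"
  using iter_mono[OF assms(1) interior_scale[OF assms(2,3)] assms(4)] iter_scale assms by simp

text \<open>
  The hypotheses on \<open>R\<close> and \<open>S\<close> say that the orbit of \<open>x\<close> is bounded in Thompson's metric. The
  points \<open>y\<close> for which \<open>f\<^sup>k x / R \<le> y \<le> S (f\<^sup>k x)\<close> holds asymptotically, that is, for each \<open>t > 1\<close>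
  eventually in \<open>k\<close> up to the factor \<open>t\<close>, form a bounded convex set: order intervals are convex and
  play the role of Thompson balls. It is invariant because \<open>f\<close> shifts \<open>k\<close> by one, it contains \<open>x\<close>,
  and the factor \<open>t\<close> makes it closed. So the fixed point property applies.
\<close>

lemma bounded_orbit_fixed_point:
  assumes fpp: "fixed_point_property (interior C) (thompson_dist C) f"
    and x: "x \<in> interior C" and RS: "0 < R" "0 < S"
    and up: "\<And>k. (f ^^ k) x \<preceq> R *\<^sub>R x" and low: "\<And>k. x \<preceq> S *\<^sub>R (f ^^ k) x"
  shows "\<exists>y\<in>interior C. f y = y"
proof -
  define P where "P t y k \<longleftrightarrow> (f ^^ k) x \<preceq> (t * R) *\<^sub>R y \<and> y \<preceq> (t * S) *\<^sub>R (f ^^ k) x" for t y k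
  define D where "D = {y \<in> interior C. \<forall>t>1. \<forall>\<^sub>F k in sequentially. P t y k}"
  have D_int: "D \<subseteq> interior C" by (auto simp: D_def)
  have pow_C: "(f ^^ k) x \<in> C" for k using iter_interior[OF x] interior_subset by blast
  have "x \<in> D"
  proof -
    have "P t x k" if "1 < t" for t k
    proof -
      have "R *\<^sub>R x \<preceq> (t * R) *\<^sub>R x" "S *\<^sub>R (f ^^ k) x \<preceq> (t * S) *\<^sub>R (f ^^ k) x"
        using that RS x interior_subset pow_C by (auto intro!: le_scale_left)
      then show ?thesis using le_trans[OF up] le_trans[OF low] by (simp add: P_def)
    qed
    then show ?thesis using x by (auto simp: D_def intro!: always_eventually)
  qed
  moreover have "T.mbounded D"
  proof -
    have "thompson_dist C x y \<le> ln (2 * R * S)" if y: "y \<in> D" for y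
    proof -
      have yi: "y \<in> interior C" using y D_int by auto
      have "\<forall>\<^sub>F k in sequentially. P 2 y k" using y unfolding D_def by force
      then obtain k where k: "P 2 y k" using eventually_happens by force
      have "x \<preceq> S *\<^sub>R (2 * R) *\<^sub>R y"
        using k RS by (intro le_trans[OF low[of k]] le_scale) (auto simp: P_def)
      moreover have "y \<preceq> (2 * S) *\<^sub>R R *\<^sub>R x"
        using k RS by (intro le_trans[OF _ le_scale[OF up[of k]]]) (auto simp: P_def)
      ultimately show ?thesis using x yi by (intro thompson_dist_le) (simp_all add: mult_ac)
    qed
    then have "D \<subseteq> T.mcball x (ln (2 * R * S))" using D_int x by (auto simp: T.in_mcball)
    then show ?thesis by (auto simp: T.mbounded_def)
  qed
  moreover have "convex D"
  proof (rule convexI)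
    fix y z and u v :: real
    assume yz: "y \<in> D" "z \<in> D" and uv: "0 \<le> u" "0 \<le> v" "u + v = 1"
    have "u *\<^sub>R y + v *\<^sub>R z \<in> interior C"
      using convex_interior[of C] pointed yz D_int uv by (auto simp: pointed_cone_def convex_def)
    moreover have "\<forall>\<^sub>F k in sequentially. P t (u *\<^sub>R y + v *\<^sub>R z) k" if "1 < t" for t
    proof -
      have "\<forall>\<^sub>F k in sequentially. P t y k" "\<forall>\<^sub>F k in sequentially. P t z k"
        using yz that by (auto simp: D_def)
      then show ?thesis
      proof eventually_elim
        case (elim k)
        have eq: "u *\<^sub>R w + v *\<^sub>R w = w" for w :: 'a
          using uv by (metis scaleR_add_left scaleR_one)
        have "u *\<^sub>R (f ^^ k) x + v *\<^sub>R (f ^^ k) x \<preceq> u *\<^sub>R (t * R) *\<^sub>R y + v *\<^sub>R (t * R) *\<^sub>R z"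
          "u *\<^sub>R y + v *\<^sub>R z \<preceq> u *\<^sub>R (t * S) *\<^sub>R (f ^^ k) x + v *\<^sub>R (t * S) *\<^sub>R (f ^^ k) x"
          using elim uv by (auto simp only: P_def intro!: le_add le_scale)
        from this[unfolded eq] show ?case by (simp add: P_def scaleR_add_right mult_ac)
      qed
    qed
    ultimately show "u *\<^sub>R y + v *\<^sub>R z \<in> D" by (simp add: D_def)
  qed
  moreover have "closedin T.mtopology D"
    unfolding T.closedin_metric
  proof (intro conjI allI impI D_int)
    fix y assume y: "y \<in> interior C - D"
    then obtain t where t: "1 < t" "\<not> (\<forall>\<^sub>F k in sequentially. P t y k)" by (auto simp: D_def)
    \<comment> \<open>Points at distance less than \<open>ln (sqrt t)\<close> from \<open>y\<close> lie outside \<open>D\<close>: half of the slack \<open>t\<close>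
      is spent on the distance and half on the condition for membership in \<open>D\<close>.\<close>
    define s where "s = sqrt t"
    have s: "1 < s" "s * s = t" using t by (auto simp: s_def)
    have "z \<notin> D" if z: "z \<in> interior C" "thompson_dist C y z < ln s" for z
    proof
      assume "z \<in> D"
      then have "\<forall>\<^sub>F k in sequentially. P s z k" using s by (auto simp: D_def)
      then have "\<forall>\<^sub>F k in sequentially. P t y k"
      proof eventually_elim
        case (elim k)
        have yz: "y \<preceq> s *\<^sub>R z" "z \<preceq> s *\<^sub>R y"
          using le_of_thompson_dist_less[of y z s] y z s by auto
        have "(f ^^ k) x \<preceq> (s * R) *\<^sub>R s *\<^sub>R y"
          using elim s RS by (intro le_trans[OF _ le_scale[OF yz(2)]]) (auto simp: P_def)
        moreover have "y \<preceq> s *\<^sub>R (s * S) *\<^sub>R (f ^^ k) x"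
          using elim s by (intro le_trans[OF yz(1)] le_scale) (auto simp: P_def)
        ultimately show ?case by (simp add: P_def mult_ac flip: s(2))
      qed
      with t show False by simp
    qed
    then have "disjnt D (T.mball y (ln s))" by (auto simp: disjnt_def T.in_mball)
    then show "\<exists>r>0. disjnt D (T.mball y r)" using s by (intro exI[of _ "ln s"]) auto
  qed
  moreover have "f ` D \<subseteq> D"
  proof safe
    fix y assume y: "y \<in> D"
    have yi: "y \<in> interior C" using y D_int by auto
    have "\<forall>\<^sub>F k in sequentially. P t (f y) k" if t: "1 < t" for t
    proof -
      have "\<forall>\<^sub>F k in sequentially. P t y k" using y t by (auto simp: D_def)
      then have "\<forall>\<^sub>F k in sequentially. P t (f y) (Suc k)"
      proof eventually_elim
        case (elim k)
        have "0 < t * R" "0 < t * S" using t RS by auto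
        with elim yi iter_interior[OF x] show ?case
          using iter_le_scale[of "(f ^^ k) x" y "t * R" 1] iter_le_scale[of y "(f ^^ k) x" "t * S" 1]
          by (simp add: P_def)
      qed
      then show ?thesis by (simp only: eventually_sequentially_Suc)
    qed
    then show "f y \<in> D" using yi self_map by (auto simp: D_def)
  qed
  ultimately have "\<exists>y\<in>D. f y = y" using fpp unfolding fixed_point_property_def by blast
  then show ?thesis using D_int by auto
qed

end

section \<open>The partial spectral radius on a normal cone\<close>

locale normal_cone_map = cone_map +
  assumes normal: "normal_cone C"
begin

text \<open>
  Up to a constant, the norm of \<open>f\<^sup>k\<close> on the interior is controlled by how \<open>f\<^sup>k\<close> moves a single interior
  point \<open>z\<close>: the unit ball lies below a multiple of \<open>z\<close>, and by normality order bounds are norm bounds.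
\<close>

lemma partial_norm_bound:
  assumes z: "z \<in> interior C"
  obtains K where "0 \<le> K"
    and "\<And>k t x. 0 < t \<Longrightarrow> (f ^^ k) z \<preceq> t *\<^sub>R z \<Longrightarrow> x \<in> interior C \<Longrightarrow> norm x \<le> 1
          \<Longrightarrow> norm ((f ^^ k) x) \<le> K * t"
proof -
  obtain \<kappa> where \<kappa>: "0 \<le> \<kappa>" "\<And>x y. 0 \<preceq> x \<Longrightarrow> x \<preceq> y \<Longrightarrow> norm x \<le> \<kappa> * norm y"
    using normal by (auto simp: normal_cone_def)
  obtain R where R: "0 < R" "\<And>x. x \<preceq> (R * norm x) *\<^sub>R z" using interior_order_unit[OF z] by metis
  have zC: "z \<in> C" using z interior_subset by auto
  have "norm ((f ^^ k) x) \<le> \<kappa> * R * norm z * t"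
    if t: "0 < t" "(f ^^ k) z \<preceq> t *\<^sub>R z" and x: "x \<in> interior C" "norm x \<le> 1" for k t x
  proof -
    have "x \<preceq> R *\<^sub>R z"
      using le_trans[OF R(2)[of x] le_scale_left[OF zC, of "R * norm x" R]] R(1) x by simp
    from iter_le_scale[OF x(1) z R(1) this]
    have "(f ^^ k) x \<preceq> R *\<^sub>R t *\<^sub>R z"
      using le_trans le_scale[OF t(2), of R] R(1) by auto
    moreover have "0 \<preceq> (f ^^ k) x"
      using iter_interior[OF x(1), of k] interior_subset by (auto simp: cone_le_def)
    ultimately have "norm ((f ^^ k) x) \<le> \<kappa> * norm (R *\<^sub>R t *\<^sub>R z)" by (intro \<kappa>(2))
    then show ?thesis using R(1) t by (simp add: mult_ac)
  qed
  with \<kappa>(1) R(1) show ?thesis by (intro that[of "\<kappa> * R * norm z"]) auto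
qed

text \<open>
  A strict contraction \<open>f\<^sup>k z \<preceq> z / 2\<close> would propagate to \<open>f\<^sup>n\<^sup>k z \<preceq> z / 2\<^sup>n\<close> and force the partial
  spectral radius below 1.
\<close>

lemma no_contraction:
  assumes r: "partial_spectral_radius (interior C) f = 1" and z: "z \<in> interior C" and k: "1 \<le> k"
  shows "\<not> (f ^^ k) z \<preceq> (1 / 2) *\<^sub>R z"
proof
  assume half: "(f ^^ k) z \<preceq> (1 / 2) *\<^sub>R z"
  define p where "p n = partial_norm (interior C) (f ^^ n)" for n
  let ?B = "{x \<in> interior C. norm x \<le> 1}"
  obtain K where K: "0 \<le> K" "\<And>k t x. 0 < t \<Longrightarrow> (f ^^ k) z \<preceq> t *\<^sub>R z \<Longrightarrow> x \<in> interior C \<Longrightarrow> norm x \<le> 1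
          \<Longrightarrow> norm ((f ^^ k) x) \<le> K * t"
    using partial_norm_bound[OF z] by metis
  have z0: "z \<noteq> 0" using z zero_not_interior by auto
  define u where "u = (1 / norm z) *\<^sub>R z"
  have u: "u \<in> ?B" using z0 z interior_scale[OF z, of "1 / norm z"] by (simp add: u_def)
  have ub: "p n \<le> K * t" if "0 < t" "(f ^^ n) z \<preceq> t *\<^sub>R z" for n t
    unfolding p_def partial_norm_def using u that by (intro cSUP_least) (auto intro: K(2))
  have bdd: "bdd_above ((\<lambda>x. norm ((f ^^ n) x)) ` ?B)" for n
  proof -
    obtain R where R: "0 < R" "\<And>x. x \<preceq> (R * norm x) *\<^sub>R z" using interior_order_unit[OF z] by metis
    have "(f ^^ n) z \<noteq> 0" using iter_interior[OF z, of n] zero_not_interior by auto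
    then have "0 < R * norm ((f ^^ n) z)" using R(1) by simp
    from K(2)[OF this R(2)] show ?thesis by (auto intro!: bdd_aboveI)
  qed
  have upper: "norm ((f ^^ n) x) \<le> p n" if "x \<in> ?B" for n x
    unfolding p_def partial_norm_def using that by (intro cSUP_upper bdd)
  have pos: "0 < p n" for n
  proof -
    have "(f ^^ n) u \<noteq> 0" using iter_interior[of u n] u zero_not_interior by auto
    then have "0 < norm ((f ^^ n) u)" by simp
    also have "\<dots> \<le> p n" by (rule upper[OF u])
    finally show ?thesis .
  qed
  have upper': "norm ((f ^^ n) x) \<le> p n * norm x" if x: "x \<in> interior C" for n x
  proof -
    have x0: "0 < norm x" using x zero_not_interior by auto
    then have "(1 / norm x) *\<^sub>R x \<in> ?B" using interior_scale[OF x, of "1 / norm x"] by simp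
    from upper[OF this, of n] x0 show ?thesis by (simp add: iter_scale[OF x] field_simps)
  qed
  have sub: "p (m + n) \<le> p m * p n" for m n
  proof -
    have "norm ((f ^^ (m + n)) x) \<le> p m * p n" if "x \<in> ?B" for x
    proof -
      have "norm ((f ^^ (m + n)) x) \<le> p m * norm ((f ^^ n) x)"
        using upper'[of "(f ^^ n) x" m] iter_interior that by (simp add: funpow_add)
      also have "\<dots> \<le> p m * p n" using upper[OF that, of n] pos[of m] by simp
      finally show ?thesis .
    qed
    then show ?thesis using u unfolding p_def[of "m + n"] partial_norm_def by (intro cSUP_least) auto
  qed
  obtain L where L: "(\<lambda>n. root n (p n)) \<longlonglongrightarrow> L" "\<And>m. 1 \<le> m \<Longrightarrow> L ^ m \<le> p m"
    using submultiplicative_root_limit[OF pos sub] by metis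
  have "L = 1" using r limI[OF L(1)] by (simp add: partial_spectral_radius_def p_def)
  then have ge1: "1 \<le> p m" if "1 \<le> m" for m using L(2)[OF that] by simp
  \<comment> \<open>By Fekete's lemma the norms of all iterates are at least 1, whereas those of \<open>f\<^sup>n\<^sup>k\<close> tend to 0.\<close>
  have contr: "(f ^^ (n * k)) z \<preceq> ((1 / 2) ^ n) *\<^sub>R z" for n
  proof (induction n)
    case 0 show ?case by (simp add: le_refl)
  next
    case (Suc n)
    have "(f ^^ k) ((f ^^ (n * k)) z) \<preceq> ((1 / 2) ^ n) *\<^sub>R (f ^^ k) z"
      using Suc by (intro iter_le_scale iter_interior z) auto
    also have "\<dots> \<preceq> ((1 / 2) ^ n) *\<^sub>R (1 / 2) *\<^sub>R z" by (intro le_scale half) auto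
    finally show ?case by (simp add: funpow_add mult_ac)
  qed
  obtain n where n: "(1 / 2) ^ n < 1 / (K + 1)"
    using real_arch_pow_inv[of "1 / (K + 1)" "1 / 2"] K(1) by auto
  have "(1 / 2 :: real) ^ Suc n \<le> (1 / 2) ^ n" by simp
  then have n': "(1 / 2) ^ Suc n < 1 / (K + 1)" using n by linarith
  have "1 \<le> p (Suc n * k)" using k by (intro ge1) simp
  also have "\<dots> \<le> K * (1 / 2) ^ Suc n" by (intro ub contr) auto
  also have "\<dots> \<le> K * (1 / (K + 1))" using n' K(1) by (intro mult_left_mono) auto
  also have "\<dots> < 1" using K(1) by (simp add: field_simps)
  finally show False by simp
qed

text \<open>The iterates of a point stay away from 0.\<close>

lemma orbit_norm_lower_bound:
  assumes r: "partial_spectral_radius (interior C) f = 1" and z: "z \<in> interior C"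
  obtains \<eta> where "0 < \<eta>" and "\<And>k. 1 \<le> k \<Longrightarrow> \<eta> \<le> norm ((f ^^ k) z)"
proof -
  obtain R where R: "0 < R" "\<And>x. x \<preceq> (R * norm x) *\<^sub>R z" using interior_order_unit[OF z] by metis
  have "1 / (2 * R) \<le> norm ((f ^^ k) z)" if k: "1 \<le> k" for k
  proof (rule ccontr)
    assume "\<not> ?thesis"
    then have "R * norm ((f ^^ k) z) \<le> 1 / 2" using R(1) by (simp add: field_simps)
    then have "(f ^^ k) z \<preceq> (1 / 2) *\<^sub>R z"
      using le_trans[OF R(2) le_scale_left] z interior_subset by blast
    with no_contraction[OF r z k] show False by simp
  qed
  then show ?thesis using R(1) by (intro that[of "1 / (2 * R)"]) auto
qed

end

section \<open>Limit sets of the normalized map\<close>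

text \<open>The normalization of \<open>f\<close> by \<open>q\<close> commutes with iteration.\<close>

lemma iter_normalized_map:
  assumes K: "f ` K \<subseteq> K" "\<forall>x\<in>K. \<forall>t>0. t *\<^sub>R x \<in> K"
    and hom: "homogeneous_on K f" "homogeneous_on K q"
    and q: "\<forall>x\<in>K. 0 < (q x :: real)"
    and g: "\<forall>x\<in>{x \<in> K. q x = 1}. g x = f x /\<^sub>R q (f x)"
    and z: "z \<in> K" "q z = 1"
  shows "(g ^^ k) z = (f ^^ k) z /\<^sub>R q ((f ^^ k) z)"
proof (induction k)
  case 0 then show ?case using z by simp
next
  case (Suc k)
  define y where "y = (f ^^ k) z"
  have y: "y \<in> K" unfolding y_def using K z by (induction k) auto
  then have fy: "f y \<in> K" using K by auto
  have l: "0 < q y" "0 < q (f y)" using q y fy by auto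
  have "y /\<^sub>R q y \<in> K" "q (y /\<^sub>R q y) = 1"
    using K(2) hom(2) y l by (auto simp: homogeneous_on_def)
  then have "g (y /\<^sub>R q y) = f (y /\<^sub>R q y) /\<^sub>R q (f (y /\<^sub>R q y))" using g by simp
  also have "f (y /\<^sub>R q y) = f y /\<^sub>R q y" using hom(1) y l by (simp add: homogeneous_on_def)
  also have "q (f y /\<^sub>R q y) = q (f y) / q y"
    using hom(2) fy l by (simp add: homogeneous_on_def divide_inverse_commute)
  finally show ?case using Suc l by (simp add: y_def inverse_eq_divide)
qed

theorem theorem7p1:
  fixes C :: "'a::banach set"
    and f g :: "'a \<Rightarrow> 'a"
    and q :: "'a \<Rightarrow> real"
    and \<Sigma> :: "'a set"
  assumes "pointed_cone C" and "closed C" and "normal_cone C" and "interior C \<noteq> {}"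
    and "f ` interior C \<subseteq> interior C"
    and "\<forall>x\<in>interior C. f x \<noteq> x"
    and "order_preserving_on C (interior C) f"
    and "homogeneous_on (interior C) f"
    and "partial_spectral_radius (interior C) f = 1"
    and "fixed_point_property (interior C) (thompson_dist C) f"
    and "\<forall>x\<in>interior C. 0 < q x"
    and "continuous_on (interior C) q"
    and "homogeneous_on (interior C) q"
    and "\<Sigma> = {x \<in> interior C. q x = 1}"
    and "\<forall>x\<in>\<Sigma>. g x = f x /\<^sub>R q (f x)"
    and "\<exists>x0\<in>interior C. compact (closure (orbit_of x0 f)) \<and>
                          compact (closure (orbit_of (x0 /\<^sub>R q x0) g))"
  shows "\<exists>\<Omega>. convex \<Omega> \<and> \<Omega> \<subseteq> frontier C \<and> (\<forall>z\<in>\<Sigma>. omega_limit z g \<subseteq> \<Omega>)"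
proof -
  \<comment> \<open>By homogeneity 0 would be a fixed point.\<close>
  have "0 \<notin> interior C"
  proof
    assume 0: "0 \<in> interior C"
    then have "f ((2::real) *\<^sub>R 0) = (2::real) *\<^sub>R f 0"
      using assms(8) unfolding homogeneous_on_def by (metis zero_less_numeral)
    then have "f 0 = 0" by (simp add: scaleR_2)
    with 0 assms(6) show False by auto
  qed
  then interpret normal_cone_map C f
    using assms by unfold_locales auto
  obtain x where x: "x \<in> interior C" and cpt: "compact (closure (orbit_of x f))"
    using assms(16) by auto
  have xC: "x \<in> C" using x interior_subset by auto
  have pow_C: "(f ^^ p) x \<in> C" for p using iter_interior[OF x] interior_subset by blast
  obtain R where R: "0 < R" "\<And>k. (f ^^ k) x \<preceq> R *\<^sub>R x"
  proof -
    have "bounded (orbit_of x f)"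
      using cpt compact_imp_bounded bounded_subset closure_subset by blast
    then obtain b where b: "0 < b" "\<And>k. norm ((f ^^ k) x) \<le> b"
      by (auto simp: bounded_pos orbit_of_def)
    obtain r where r: "0 < r" "\<And>y. y \<preceq> (r * norm y) *\<^sub>R x" using interior_order_unit[OF x] by metis
    have "(f ^^ k) x \<preceq> (r * b) *\<^sub>R x" for k
      using le_trans[OF r(2) le_scale_left[OF xC]] b r(1) by (simp add: mult_left_mono)
    then show ?thesis using that[of "r * b"] b r by auto
  qed
  \<comment> \<open>Since the orbit is bounded above by \<open>R x\<close>, every iterate dominates all later ones up to
    the factor \<open>R\<close>, and hence their limits.\<close>
  have later: "(f ^^ (p + m)) x \<preceq> R *\<^sub>R (f ^^ p) x" for p m
    using iter_le_scale[OF iter_interior[OF x] x R, of p m] by (simp add: funpow_add)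
  define \<Omega> where "\<Omega> = {v \<in> C. \<exists>t\<ge>0. \<forall>p. v \<preceq> t *\<^sub>R (f ^^ p) x}"
  have "convex \<Omega>"
  proof (rule convexI)
    fix v w and a b :: real
    assume "v \<in> \<Omega>" "w \<in> \<Omega>" and ab: "0 \<le> a" "0 \<le> b" "a + b = 1"
    then obtain s t where st: "v \<in> C" "w \<in> C" "0 \<le> s" "0 \<le> t"
      "\<And>p. v \<preceq> s *\<^sub>R (f ^^ p) x" "\<And>p. w \<preceq> t *\<^sub>R (f ^^ p) x" by (auto simp: \<Omega>_def)
    have "a *\<^sub>R v + b *\<^sub>R w \<in> C" using st ab by (intro add_mem scale_mem)
    moreover have "a *\<^sub>R v + b *\<^sub>R w \<preceq> (a * s + b * t) *\<^sub>R (f ^^ p) x" for p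
      using le_add[OF le_scale[OF st(5) ab(1)] le_scale[OF st(6) ab(2)]] by (simp add: scaleR_add_left)
    moreover have "0 \<le> a * s + b * t" using st ab by simp
    ultimately show "a *\<^sub>R v + b *\<^sub>R w \<in> \<Omega>" by (auto simp: \<Omega>_def)
  qed
  moreover have "\<Omega> \<subseteq> frontier C"
  proof -
    have "v \<notin> interior C" if v: "v \<in> \<Omega>" for v
    proof
      assume vi: "v \<in> interior C"
      obtain t where t: "0 \<le> t" "\<And>p. v \<preceq> t *\<^sub>R (f ^^ p) x" using v by (auto simp: \<Omega>_def)
      obtain r where r: "0 < r" "\<And>y. y \<preceq> (r * norm y) *\<^sub>R v" using interior_order_unit[OF vi] by metis
      define S where "S = r * norm x * t + 1"
      have S: "0 < S" using r(1) t(1) by (simp add: S_def add_nonneg_pos)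
      have "x \<preceq> S *\<^sub>R (f ^^ p) x" for p
      proof -
        have "x \<preceq> (r * norm x) *\<^sub>R v" by (rule r(2))
        also have "\<dots> \<preceq> (r * norm x) *\<^sub>R t *\<^sub>R (f ^^ p) x" using r(1) by (intro le_scale t) auto
        also have "\<dots> = (r * norm x * t) *\<^sub>R (f ^^ p) x" by simp
        also have "\<dots> \<preceq> S *\<^sub>R (f ^^ p) x" by (intro le_scale_left pow_C) (simp add: S_def)
        finally show ?thesis .
      qed
      from bounded_orbit_fixed_point[OF assms(10) x R(1) S R(2) this] assms(6) show False by auto
    qed
    then show ?thesis using assms(2) by (auto simp: \<Omega>_def frontier_def)
  qed
  moreover have "omega_limit z g \<subseteq> \<Omega>" if z: "z \<in> \<Sigma>" for z
  proof
    fix w assume "w \<in> omega_limit z g"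
    then obtain k :: "nat \<Rightarrow> nat" where k: "filterlim k at_top sequentially"
      and lim: "(\<lambda>i. (g ^^ k i) z) \<longlonglongrightarrow> w" by (auto simp: omega_limit_def)
    have zi: "z \<in> interior C" "q z = 1" using z assms(14) by auto
    define c where "c n = inverse (q ((f ^^ n) z))" for n
    have c: "0 < c n" for n using assms(11) iter_interior[OF zi(1)] by (simp add: c_def)
    have g: "(g ^^ n) z = c n *\<^sub>R (f ^^ n) z" for n
      using iter_normalized_map[of f "interior C" q g z n] assms interior_scale zi
      by (simp add: c_def)
    obtain \<eta> where \<eta>: "0 < \<eta>" "\<And>n. 1 \<le> n \<Longrightarrow> \<eta> \<le> norm ((f ^^ n) z)"
      using orbit_norm_lower_bound[OF assms(9) zi(1)] by metis
    \<comment> \<open>The values of \<open>q\<close> along the subsequence stay away from 0, because \<open>g\<^sup>k z\<close> converges and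
      \<open>f\<^sup>k z\<close> stays away from 0. No control of \<open>q\<close> near the boundary is needed.\<close>
    obtain b where b: "0 < b" "\<And>i. norm ((g ^^ k i) z) \<le> b"
      using convergent_imp_Bseq[of "\<lambda>i. (g ^^ k i) z"] lim
      unfolding convergent_def Bseq_def by metis
    have c_le: "c (k i) \<le> b / \<eta>" if "1 \<le> k i" for i
    proof -
      have "c (k i) * \<eta> \<le> c (k i) * norm ((f ^^ k i) z)"
        using \<eta>(2)[OF that] c by (intro mult_left_mono) (auto simp: less_imp_le)
      also have "\<dots> \<le> b" using b(2)[of i] c[of "k i"] by (simp add: g)
      finally show ?thesis using \<eta>(1) by (simp add: field_simps)
    qed
    obtain r where r: "0 < r" "\<And>y. y \<preceq> (r * norm y) *\<^sub>R x" using interior_order_unit[OF x] by metis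
    define s where "s = r * norm z"
    have "z \<noteq> 0" using zi zero_not_interior by auto
    then have s: "0 < s" using r(1) by (simp add: s_def)
    have zx: "z \<preceq> s *\<^sub>R x" using r(2) by (simp add: s_def)
    have "w \<preceq> (b / \<eta> * s * R) *\<^sub>R (f ^^ p) x" for p
    proof (rule le_limit[OF lim])
      have "\<forall>\<^sub>F i in sequentially. p + 1 \<le> k i" using k by (simp add: filterlim_at_top)
      then show "\<forall>\<^sub>F i in sequentially. (g ^^ k i) z \<preceq> (b / \<eta> * s * R) *\<^sub>R (f ^^ p) x"
      proof eventually_elim
        case (elim i)
        have "(f ^^ k i) z \<preceq> s *\<^sub>R (f ^^ k i) x" by (rule iter_le_scale[OF zi(1) x s zx])
        also have "\<dots> \<preceq> s *\<^sub>R R *\<^sub>R (f ^^ p) x"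
          using later[of p "k i - p"] elim s by (intro le_scale) auto
        finally have "c (k i) *\<^sub>R (f ^^ k i) z \<preceq> c (k i) *\<^sub>R s *\<^sub>R R *\<^sub>R (f ^^ p) x"
          using c[of "k i"] by (intro le_scale) auto
        also have "\<dots> = (c (k i) * (s * R)) *\<^sub>R (f ^^ p) x" by simp
        also have "\<dots> \<preceq> (b / \<eta> * (s * R)) *\<^sub>R (f ^^ p) x"
          using c_le[of i] elim s R(1) by (intro le_scale_left pow_C mult_right_mono) auto
        finally show ?case by (simp add: g mult.assoc)
      qed
    qed
    moreover have "0 \<le> b / \<eta> * s * R" using b \<eta> s R by simp
    moreover have "w \<in> C"
    proof (rule Lim_in_closed_set[OF assms(2) _ _ lim])
      show "\<forall>\<^sub>F i in sequentially. (g ^^ k i) z \<in> C"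
        using iter_interior[OF zi(1)] interior_subset c
        by (intro always_eventually) (auto simp: g less_imp_le intro!: scale_mem)
    qed simp
    ultimately show "w \<in> \<Omega>" by (auto simp: \<Omega>_def)
  qed
  ultimately show ?thesis by blast
qed

end
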